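(* Let $1\le p<\infty$, let $E$ be a Banach lattice, let $X$ be a Banach space, and let $T:E\to X$ be a Dunford-Pettis $p$-convergent operator. If the adjoint $T^*:X^*\to E^*$ of $T$ is Dunford-Pettis $p$-convergent, then one of the following assertions holds: (i) the norm of $E^*$ is order continuous; (ii) $X^*$ has the $p$-$(DPrcP)$.
   Context: A sequence $(x_n)_n$ in a Banach space $Z$ is weakly $p$-summable if $(z^*(x_n))_n\in\ell_p$ for every $z^*\in Z^*$. A bounded set $K\subseteq Z$ is a Dunford-Pettis set if every weakly null sequence $(z_n^* )_n$ in $Z^*$ converges to $0$ uniformly on $K$. A bounded linear operator between Banach spaces is Dunford-Pettis $p$-convergent if it takes every weakly $p$-summable sequence whose set of terms is a Dunford-Pettis set to a norm null sequence. A Banach space $Z$ has the $p$-Dunford-Pettis relatively compact property ($p$-$(DPrcP)$) if every weakly $p$-summable sequence in $Z$ whose set of terms is a Dunford-Pettis set is norm null. The norm of a Banach lattice is order continuous if every net $(x_\alpha)$ with $x_\alpha\downarrow 0$ (that is, decreasing with infimum existing and equal to $0$) converges to $0$ in norm.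
   Formalization: The hypothesis is taken for all operators: every Dunford-Pettis p-convergent T from E to X is assumed to have a Dunford-Pettis p-convergent adjoint. For a single T the claim is false, e.g. T = 0 with E = X = l^1. *)

theory Defs
  imports "HOL-Analysis.Analysis" "HOL-Library.Lattice_Algebras"
begin

text \<open>Banach lattices. The modulus is the lattice one: \<open>\<bar>x\<bar> = sup x (- x)\<close> by
  the axiom \<open>abs_lattice\<close> of \<open>lattice_ab_group_add_abs\<close>. Spaces are real throughout.\<close>

class banach_lattice = banach + ordered_real_vector + lattice_ab_group_add_abs +
  assumes norm_mono_abs: "\<bar>x\<bar> \<le> \<bar>y\<bar> \<Longrightarrow> norm x \<le> norm y"

instance real :: banach_lattice
  by standard auto

text \<open>The dual order, i.e. the order of \<open>E\<^sup>*\<close> when the codomain is \<open>real\<close>: pointwise on the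
  positive cone. The domain has to be spanned by its positive cone for antisymmetry.\<close>

instantiation blinfun :: (banach_lattice, "{real_normed_vector, order}") order
begin

definition less_eq_blinfun :: "('a \<Rightarrow>\<^sub>L 'b) \<Rightarrow> ('a \<Rightarrow>\<^sub>L 'b) \<Rightarrow> bool"
  where "f \<le> g \<longleftrightarrow> (\<forall>x\<ge>0. blinfun_apply f x \<le> blinfun_apply g x)"

definition less_blinfun :: "('a \<Rightarrow>\<^sub>L 'b) \<Rightarrow> ('a \<Rightarrow>\<^sub>L 'b) \<Rightarrow> bool"
  where "(f :: 'a \<Rightarrow>\<^sub>L 'b) < g \<longleftrightarrow> f \<le> g \<and> \<not> g \<le> f"

instance
proof
  fix f g h :: "'a \<Rightarrow>\<^sub>L 'b"
  show "f < g \<longleftrightarrow> f \<le> g \<and> \<not> g \<le> f"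
    by (rule less_blinfun_def)
  show "f \<le> f"
    by (simp add: less_eq_blinfun_def)
  show "f \<le> g \<Longrightarrow> g \<le> h \<Longrightarrow> f \<le> h"
    unfolding less_eq_blinfun_def by (meson order_trans)
  assume "f \<le> g" "g \<le> f"
  then have pos: "blinfun_apply f x = blinfun_apply g x" if "x \<ge> 0" for x
    using that unfolding less_eq_blinfun_def by (meson order_antisym)
  show "f = g"
  proof (rule blinfun_eqI)
    fix x :: 'a
    have "x = pprt x - (- nprt x)"
      by (simp add: prts[symmetric])
    moreover have "0 \<le> pprt x" "0 \<le> - nprt x"
      by simp_all
    ultimately show "blinfun_apply f x = blinfun_apply g x"
      by (metis pos blinfun.diff_right)
  qed
qed

end

text \<open>A net is a family \<open>x\<close> over a nonempty index set \<open>I\<close> directed by the preorder \<open>le\<close>.\<close>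

definition directed_preorder :: "'i set \<Rightarrow> ('i \<Rightarrow> 'i \<Rightarrow> bool) \<Rightarrow> bool"
  where "directed_preorder I le \<longleftrightarrow>
    I \<noteq> {} \<and>
    (\<forall>i\<in>I. le i i) \<and>
    (\<forall>i\<in>I. \<forall>j\<in>I. \<forall>k\<in>I. le i j \<longrightarrow> le j k \<longrightarrow> le i k) \<and>
    (\<forall>i\<in>I. \<forall>j\<in>I. \<exists>k\<in>I. le i k \<and> le j k)"

definition net_decreases_to_zero ::
    "'i set \<Rightarrow> ('i \<Rightarrow> 'i \<Rightarrow> bool) \<Rightarrow> ('i \<Rightarrow> 'e::{order, zero}) \<Rightarrow> bool"
  where "net_decreases_to_zero I le x \<longleftrightarrow>
    (\<forall>i\<in>I. \<forall>j\<in>I. le i j \<longrightarrow> x j \<le> x i) \<and>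
    (\<forall>i\<in>I. 0 \<le> x i) \<and>
    (\<forall>y. (\<forall>i\<in>I. y \<le> x i) \<longrightarrow> y \<le> 0)"

definition net_norm_null ::
    "'i set \<Rightarrow> ('i \<Rightarrow> 'i \<Rightarrow> bool) \<Rightarrow> ('i \<Rightarrow> 'e::real_normed_vector) \<Rightarrow> bool"
  where "net_norm_null I le x \<longleftrightarrow>
    (\<forall>\<epsilon>>0. \<exists>i\<^sub>0\<in>I. \<forall>i\<in>I. le i\<^sub>0 i \<longrightarrow> norm (x i) < \<epsilon>)"

text \<open>HOL cannot quantify over the type of the indices inside a definition, so that type is a
  parameter. Left as a free type variable in a theorem, it is universally quantified, so that
  nets over arbitrary index sets are covered.\<close>

definition order_continuous_norm ::
    "'i itself \<Rightarrow> 'e::{real_normed_vector, order} itself \<Rightarrow> bool"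
  where "order_continuous_norm _ _ \<longleftrightarrow>
    (\<forall>(I :: 'i set) le (x :: 'i \<Rightarrow> 'e).
      directed_preorder I le \<longrightarrow> net_decreases_to_zero I le x \<longrightarrow> net_norm_null I le x)"

definition weakly_p_summable :: "real \<Rightarrow> (nat \<Rightarrow> 'z::real_normed_vector) \<Rightarrow> bool"
  where "weakly_p_summable p x \<longleftrightarrow>
    (\<forall>f :: 'z \<Rightarrow>\<^sub>L real. summable (\<lambda>n. \<bar>blinfun_apply f (x n)\<bar> powr p))"

definition weakly_null :: "(nat \<Rightarrow> 'z::real_normed_vector) \<Rightarrow> bool"
  where "weakly_null x \<longleftrightarrow> (\<forall>f :: 'z \<Rightarrow>\<^sub>L real. (\<lambda>n. blinfun_apply f (x n)) \<longlonglongrightarrow> 0)"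

definition Dunford_Pettis_set :: "'z::real_normed_vector set \<Rightarrow> bool"
  where "Dunford_Pettis_set K \<longleftrightarrow>
    bounded K \<and>
    (\<forall>f :: nat \<Rightarrow> 'z \<Rightarrow>\<^sub>L real. weakly_null f \<longrightarrow>
      uniform_limit K (\<lambda>n. blinfun_apply (f n)) (\<lambda>_. 0) sequentially)"

definition Dunford_Pettis_p_convergent ::
    "real \<Rightarrow> ('z::real_normed_vector \<Rightarrow>\<^sub>L 'w::real_normed_vector) \<Rightarrow> bool"
  where "Dunford_Pettis_p_convergent p T \<longleftrightarrow>
    (\<forall>x. weakly_p_summable p x \<longrightarrow> Dunford_Pettis_set (range x) \<longrightarrow>
      (\<lambda>n. blinfun_apply T (x n)) \<longlonglongrightarrow> 0)"

definition p_DPrcP :: "real \<Rightarrow> 'z::real_normed_vector itself \<Rightarrow> bool"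
  where "p_DPrcP p _ \<longleftrightarrow>
    (\<forall>x :: nat \<Rightarrow> 'z. weakly_p_summable p x \<longrightarrow> Dunford_Pettis_set (range x) \<longrightarrow> x \<longlonglongrightarrow> 0)"

lift_definition blinfun_adjoint ::
    "('z::real_normed_vector \<Rightarrow>\<^sub>L 'w::real_normed_vector) \<Rightarrow> ('w \<Rightarrow>\<^sub>L real) \<Rightarrow>\<^sub>L ('z \<Rightarrow>\<^sub>L real)"
  is "\<lambda>T f. f o\<^sub>L T"
  by (rule bounded_bilinear.bounded_linear_left[OF bounded_bilinear_blinfun_compose])

end

theory Submission
  imports Defs
begin

text \<open>
  Suppose that both alternatives fail; a Dunford-Pettis \<open>p\<close>-convergent operator \<open>T\<close> is built whose
  adjoint is not. It factors through \<open>\<ell>\<^sub>1\<close>: \<open>T x = (\<Sum>n. \<phi>\<^sub>n(x) y\<^sub>n)\<close>, with functionals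
  \<open>\<phi>\<^sub>n\<close> such that \<open>\<Sum>\<bar>\<phi>\<^sub>n(x)\<bar> \<le> C \<parallel>x\<parallel>\<close>, and \<open>y\<^sub>n\<close> in the unit ball of \<open>X\<close>.

  Every operator of this form is Dunford-Pettis \<open>p\<close>-convergent
  (\<open>Dunford_Pettis_p_convergent_of_summable_functionals\<close>). The signed block sums of \<open>\<phi>\<close> over
  \<open>{N..<M\<^sub>N}\<close> are weakly null as \<open>N\<close> grows, so on a Dunford-Pettis set the tails of
  \<open>\<Sum>\<bar>\<phi>\<^sub>n(x)\<bar>\<close> are uniformly small. Along a weakly \<open>p\<close>-summable sequence each single coordinate
  tends to \<open>0\<close>, hence so does the whole sum.

  The functionals come from a net in \<open>E\<^sup>*\<close> that decreases to \<open>0\<close> but not in norm. Such a net tends to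
  \<open>0\<close> pointwise on the positive cone, so one can pick alternately members \<open>g\<^sub>n\<close> of the net and positive
  \<open>u\<^sub>n\<close> in the unit ball with \<open>g\<^sub>n(u\<^sub>n) > c\<close> and \<open>g\<^sub>n\<^sub>+\<^sub>1(u\<^sub>n)\<close> small. Put
  \<open>\<phi>\<^sub>n = g\<^sub>n - g\<^sub>n\<^sub>+\<^sub>1\<close>. The sums telescope: \<open>\<Sum>\<bar>\<phi>\<^sub>n(x)\<bar> \<le> g\<^sub>0(\<bar>x\<bar>)\<close>,
  \<open>\<phi>\<^sub>n(u\<^sub>n)\<close> is bounded away from \<open>0\<close>, and \<open>\<Sum>\<phi>\<^sub>m(u\<^sub>n)\<close> over \<open>m > n\<close> is small.

  These functionals need not be disjoint: nothing makes \<open>\<phi>\<^sub>m(u\<^sub>n)\<close> small for \<open>m < n\<close>. The vectors \<open>y\<^sub>n\<close>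
  compensate for this. A sequence \<open>f\<close> that refutes the \<open>p\<close>-(DPrcP) of \<open>X\<^sup>*\<close> is weak* null but not norm
  null, so there are \<open>k\<^sub>n \<ge> n\<close> and \<open>y\<^sub>n\<close> such that \<open>f\<^bsub>k(n)\<^esub>(y\<^sub>n) > \<eta>\<close>, while
  \<open>f\<^bsub>k(n)\<^esub>(y\<^sub>m)\<close> is small for \<open>m < n\<close>. In
  \<open>(T\<^sup>*f\<^bsub>k(n)\<^esub>)(u\<^sub>n) = (\<Sum>m. \<phi>\<^sub>m(u\<^sub>n) f\<^bsub>k(n)\<^esub>(y\<^sub>m))\<close> the term \<open>m = n\<close> then dominates
  both remaining parts, and \<open>T\<^sup>*f\<^sub>k\<close> does not tend to \<open>0\<close> in norm.
\<close>

section \<open>Positive functionals on a Banach lattice\<close>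

lemma norm_abs_lattice: "norm \<bar>x\<bar> = norm (x :: 'e::banach_lattice)"
  by (rule antisym) (auto intro!: norm_mono_abs)

lemma positive_functional_abs_le:
  fixes f :: "'e::banach_lattice \<Rightarrow>\<^sub>L real"
  assumes "0 \<le> f"
  shows "\<bar>f x\<bar> \<le> f \<bar>x\<bar>"
proof -
  have pos: "0 \<le> f z" if "0 \<le> z" for z
    using assms that by (simp add: less_eq_blinfun_def)
  have "0 \<le> f (\<bar>x\<bar> - x)" "0 \<le> f (\<bar>x\<bar> + x)"
    using abs_ge_self[of x] abs_ge_minus_self[of x]
    by (auto intro!: pos simp: le_diff_eq simp flip: diff_le_eq)
  then show ?thesis
    by (simp add: blinfun.add_right blinfun.diff_right abs_le_iff)
qed

lemma exists_unit_vector_above: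
  fixes f :: "'z::real_normed_vector \<Rightarrow>\<^sub>L real"
  assumes "0 \<le> c" "c < norm f"
  obtains y where "norm y \<le> 1" "c < f y"
proof -
  have "\<exists>x. c * norm x < norm (f x)"
    using assms norm_blinfun_bound[of c f] by (meson not_less)
  then obtain x where x: "c * norm x < \<bar>f x\<bar>" by auto
  then have nz: "norm x > 0" by auto
  define y where "y = (sgn (f x) / norm x) *\<^sub>R x"
  have "f y = \<bar>f x\<bar> / norm x"
    by (simp add: y_def blinfun.scaleR_right sgn_mult_self_eq abs_sgn mult.commute)
  then have "c < f y"
    using x nz by (simp add: pos_less_divide_eq)
  moreover have "norm y \<le> 1"
    using nz by (simp add: y_def abs_sgn_eq)
  ultimately show thesis using that by blast
qed

lemma exists_positive_unit_vector_above:
  fixes f :: "'e::banach_lattice \<Rightarrow>\<^sub>L real"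
  assumes "0 \<le> f" "0 \<le> c" "c < norm f"
  obtains u where "0 \<le> u" "norm u \<le> 1" "c < f u"
proof -
  obtain y where y: "norm y \<le> 1" "c < f y"
    using exists_unit_vector_above assms(2,3) by blast
  have "c < f \<bar>y\<bar>"
    using positive_functional_abs_le[OF assms(1), of y] y by linarith
  then show thesis
    using that[of "\<bar>y\<bar>"] y by (simp add: norm_abs_lattice)
qed

lemma norm_mono_positive_functional:
  fixes f g :: "'e::banach_lattice \<Rightarrow>\<^sub>L real"
  assumes "0 \<le> f" "f \<le> g"
  shows "norm f \<le> norm g"
proof (rule ccontr)
  assume "\<not> ?thesis"
  then obtain u where u: "0 \<le> u" "norm u \<le> 1" "norm g < f u"
    using exists_positive_unit_vector_above[OF assms(1), of "norm g"] by auto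
  have "f u \<le> g u"
    using assms(2) u(1) by (simp add: less_eq_blinfun_def)
  also have "\<dots> \<le> norm g * norm u"
    using norm_blinfun[of g u] by simp
  also have "\<dots> \<le> norm g"
    using u(2) by (simp add: mult_left_le)
  finally show False using u(3) by simp
qed

text \<open>The infimum of a decreasing net in the dual of a Banach lattice is its pointwise limit. Indeed,
  the net converges at every positive vector by monotonicity, hence everywhere by linearity; the limit is
  a bounded functional and a lower bound of the net. If the infimum is \<open>0\<close>, this limit is therefore
  \<open>\<le> 0\<close>.\<close>

lemma decreasing_net_functionals_tendsto_zero:
  fixes f :: "'i \<Rightarrow> ('e::banach_lattice \<Rightarrow>\<^sub>L real)"
  assumes dir: "directed_preorder I le"
    and dec: "net_decreases_to_zero I le f"
    and x: "0 \<le> x" and d: "0 < d"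
    and i: "i \<in> I"
  obtains j where "j \<in> I" "le i j" "f j x < d"
proof -
  \<comment> \<open>The filter of tails of the net, so that the limit laws for filters apply to nets.\<close>
  define F where "F = (INF i\<in>I. principal {j\<in>I. le i j})"
  have ev: "eventually P F \<longleftrightarrow> (\<exists>i\<in>I. \<forall>j\<in>I. le i j \<longrightarrow> P j)" for P
    unfolding F_def
  proof (subst eventually_INF_base)
    show "I \<noteq> {}" using dir by (simp add: directed_preorder_def)
    fix a b assume "a \<in> I" "b \<in> I"
    with dir obtain k where "k \<in> I" "le a k" "le b k"
      unfolding directed_preorder_def by meson
    moreover have "{j\<in>I. le k j} \<subseteq> {j\<in>I. le a j} \<inter> {j\<in>I. le b j}"
      using dir \<open>a \<in> I\<close> \<open>b \<in> I\<close> calculation unfolding directed_preorder_def by blast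
    ultimately show "\<exists>x\<in>I. principal {j\<in>I. le x j}
        \<le> inf (principal {j\<in>I. le a j}) (principal {j\<in>I. le b j})"
      by auto
  qed (auto simp: eventually_principal)
  have nb: "F \<noteq> bot"
    using dir unfolding trivial_limit_def ev directed_preorder_def by meson
  have pos: "0 \<le> f i z" if "i \<in> I" "0 \<le> z" for i z
    using dec that unfolding net_decreases_to_zero_def
    by (auto simp: less_eq_blinfun_def)
  have mono: "f j z \<le> f i z" if "i \<in> I" "j \<in> I" "le i j" "0 \<le> z" for i j z
    using dec that unfolding net_decreases_to_zero_def
    by (auto simp: less_eq_blinfun_def)
  have conv_pos: "\<exists>l. ((\<lambda>i. f i z) \<longlongrightarrow> l) F" if z: "0 \<le> z" for z
  proof -
    define l where "l = (INF i\<in>I. f i z)"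
    have bdd: "bdd_below ((\<lambda>i. f i z) ` I)"
      using pos z by (intro bdd_belowI[of _ 0]) auto
    have "((\<lambda>i. f i z) \<longlongrightarrow> l) F"
    proof (rule order_tendstoI)
      fix a assume "a < l"
      then show "eventually (\<lambda>i. a < f i z) F"
        using i bdd unfolding ev l_def
        by (metis cINF_lower order_less_le_trans)
    next
      fix a assume "l < a"
      then obtain k where "k \<in> I" "f k z < a"
        using bdd i unfolding l_def by (subst (asm) cINF_less_iff) auto
      then show "eventually (\<lambda>i. f i z < a) F"
        unfolding ev using mono z by (meson order_le_less_trans)
    qed
    then show ?thesis by blast
  qed
  have conv: "((\<lambda>i. f i z) \<longlongrightarrow> Lim F (\<lambda>i. f i z)) F" for z
  proof -
    obtain l m where "((\<lambda>i. f i (pprt z)) \<longlongrightarrow> l) F" "((\<lambda>i. f i (- nprt z)) \<longlongrightarrow> m) F"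
      using conv_pos[of "pprt z"] conv_pos[of "- nprt z"] by auto
    from tendsto_diff[OF this]
    have "((\<lambda>i. f i (pprt z - - nprt z)) \<longlongrightarrow> l - m) F"
      by (simp only: blinfun.diff_right)
    then have "((\<lambda>i. f i z) \<longlongrightarrow> l - m) F"
      by (simp add: prts[symmetric])
    then show ?thesis using tendsto_Lim[OF nb] by metis
  qed
  define h where "h z = Lim F (\<lambda>i. f i z)" for z
  note conv = conv[folded h_def]
  have h_uniq: "h z = l" if "((\<lambda>i. f i z) \<longlongrightarrow> l) F" for z l
    using tendsto_unique[OF nb conv that] .
  have h_le: "h z \<le> f k z" if "k \<in> I" "0 \<le> z" for k z
    using conv by (rule tendsto_upperbound) (use that mono nb in \<open>auto simp: ev\<close>)
  \<comment> \<open>The tail beyond \<open>i\<close> is dominated by \<open>f i\<close>, which bounds the limit.\<close>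
  have bl: "bounded_linear h"
  proof (rule bounded_linear_intro[where K = "norm (f i)"])
    show "h (a + b) = h a + h b" for a b
      by (rule h_uniq) (simp add: blinfun.add_right tendsto_add[OF conv conv])
    show "h (r *\<^sub>R a) = r *\<^sub>R h a" for r a
      by (rule h_uniq) (simp add: blinfun.scaleR_right tendsto_mult_left[OF conv])
    fix z
    have "eventually (\<lambda>j. \<bar>f j z\<bar> \<le> f i \<bar>z\<bar>) F"
      unfolding ev
    proof (intro bexI[of _ i] ballI impI i)
      fix j assume j: "j \<in> I" "le i j"
      then have "0 \<le> f j" using dec by (simp add: net_decreases_to_zero_def)
      then have "\<bar>f j z\<bar> \<le> f j \<bar>z\<bar>" by (rule positive_functional_abs_le)
      also have "\<dots> \<le> f i \<bar>z\<bar>" using mono i j by simp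
      finally show "\<bar>f j z\<bar> \<le> f i \<bar>z\<bar>" .
    qed
    then have "\<bar>h z\<bar> \<le> f i \<bar>z\<bar>"
      by (rule tendsto_upperbound[OF tendsto_rabs[OF conv] _ nb])
    also have "\<dots> \<le> norm (f i) * norm \<bar>z\<bar>"
      using norm_blinfun[of "f i" "\<bar>z\<bar>"] by simp
    finally show "norm (h z) \<le> norm z * norm (f i)"
      by (simp add: norm_abs_lattice mult.commute)
  qed
  have "Blinfun h \<le> f k" if "k \<in> I" for k
    using h_le that by (simp add: less_eq_blinfun_def bounded_linear_Blinfun_apply[OF bl])
  then have "Blinfun h \<le> 0"
    using dec by (simp add: net_decreases_to_zero_def)
  then have "h x \<le> 0"
    using x by (simp add: less_eq_blinfun_def bounded_linear_Blinfun_apply[OF bl])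
  then have "h x < d" using d by simp
  with conv have "eventually (\<lambda>i. f i x < d) F" by (rule order_tendstoD)
  then obtain k where k: "k \<in> I" "\<And>j. j \<in> I \<Longrightarrow> le k j \<Longrightarrow> f j x < d"
    unfolding ev by blast
  obtain j where "j \<in> I" "le i j" "le k j"
    using dir i k(1) unfolding directed_preorder_def by meson
  with k that show thesis by blast
qed

text \<open>The constant \<open>c\<close> must not depend on \<open>d\<close>, because \<open>d\<close> is later chosen small compared with \<open>c\<close>.
  Monotonicity of the norm upgrades frequent lower bounds to \<open>norm (f i) \<ge> e\<close> for all members of the net.
  After \<open>u\<close> has been chosen for a member of the net, pointwise convergence gives a later member that is
  small at \<open>u\<close>.\<close>

lemma decreasing_functionals_of_not_order_continuous:
  assumes "\<not> order_continuous_norm TYPE('i) TYPE('e::banach_lattice \<Rightarrow>\<^sub>L real)"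
  obtains c where "0 < c"
    and "\<And>d. 0 < d \<Longrightarrow> \<exists>(g :: nat \<Rightarrow> 'e \<Rightarrow>\<^sub>L real) u. (\<forall>n. 0 \<le> g n \<and> g (Suc n) \<le> g n \<and>
           0 \<le> u n \<and> norm (u n) \<le> 1 \<and> c < blinfun_apply (g n) (u n) \<and> blinfun_apply (g (Suc n)) (u n) < d)"
proof -
  obtain I :: "'i set" and le and f :: "'i \<Rightarrow> 'e \<Rightarrow>\<^sub>L real"
    where dir: "directed_preorder I le" and dec: "net_decreases_to_zero I le f"
      and "\<not> net_norm_null I le f"
    using assms unfolding order_continuous_norm_def by blast
  then obtain e where e: "0 < e" "\<And>i. i \<in> I \<Longrightarrow> \<exists>j\<in>I. le i j \<and> e \<le> norm (f j)"
    unfolding net_norm_null_def by (meson not_less)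
  have pos: "0 \<le> f i" if "i \<in> I" for i
    using dec that by (simp add: net_decreases_to_zero_def)
  have mono: "f j \<le> f i" if "i \<in> I" "j \<in> I" "le i j" for i j
    using dec that by (simp add: net_decreases_to_zero_def)
  have ge: "e \<le> norm (f i)" if "i \<in> I" for i
    using e(2)[OF that] mono[OF that] pos norm_mono_positive_functional
    by (meson order_trans)
  show thesis
  proof
    show "0 < e / 2" using e by simp
    fix d :: real assume d: "0 < d"
    define P where "P = (\<lambda>(n::nat) (i, u). i \<in> I \<and> 0 \<le> u \<and> norm u \<le> 1 \<and> e / 2 < f i u)"
    define Q where "Q = (\<lambda>(n::nat) (i, u :: 'e) (j, v :: 'e). le i j \<and> f j u < d)"
    have unit: "\<exists>u. P n (i, u)" if i: "i \<in> I" for i n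
    proof -
      have "e / 2 < norm (f i)" using ge[OF i] e(1) by simp
      then obtain u where "0 \<le> u" "norm u \<le> 1" "e / 2 < f i u"
        using exists_positive_unit_vector_above[OF pos[OF i], of "e / 2"] e(1) by auto
      then show ?thesis using i by (auto simp: P_def)
    qed
    have "\<exists>s. \<forall>n. P n (s n) \<and> Q n (s n) (s (Suc n))"
    proof (rule dependent_nat_choice)
      show "\<exists>s. P 0 s"
      proof -
        obtain i where "i \<in> I" using dir by (auto simp: directed_preorder_def)
        with unit show ?thesis by metis
      qed
      fix s n assume "P n s"
      moreover obtain i u where s: "s = (i, u)" by force
      ultimately have "i \<in> I" and "0 \<le> u" by (auto simp: P_def)
      obtain j where j: "j \<in> I" "le i j" "f j u < d"
        by (rule decreasing_net_functionals_tendsto_zero[OF dir dec \<open>0 \<le> u\<close> d \<open>i \<in> I\<close>])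
      obtain v where "P (Suc n) (j, v)" using unit[OF j(1)] by metis
      with j show "\<exists>t. P (Suc n) t \<and> Q n s t"
        by (intro exI[of _ "(j, v)"]) (simp add: s Q_def)
    qed
    then obtain s where s: "\<And>n. P n (s n)" "\<And>n. Q n (s n) (s (Suc n))" by blast
    show "\<exists>(g :: nat \<Rightarrow> 'e \<Rightarrow>\<^sub>L real) u. (\<forall>n. 0 \<le> g n \<and> g (Suc n) \<le> g n \<and>
           0 \<le> u n \<and> norm (u n) \<le> 1 \<and> e / 2 < blinfun_apply (g n) (u n) \<and> blinfun_apply (g (Suc n)) (u n) < d)"
    proof (intro exI[of _ "\<lambda>n. f (fst (s n))"] exI[of _ "\<lambda>n. snd (s n)"] allI)
      fix n
      show "0 \<le> f (fst (s n)) \<and> f (fst (s (Suc n))) \<le> f (fst (s n)) \<and>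
           0 \<le> snd (s n) \<and> norm (snd (s n)) \<le> 1 \<and> e / 2 < f (fst (s n)) (snd (s n)) \<and>
           f (fst (s (Suc n))) (snd (s n)) < d"
        using s(1)[of n] s(1)[of "Suc n"] s(2)[of n] pos mono
        by (auto simp: P_def Q_def split: prod.splits)
    qed
  qed
qed

section \<open>Operators that factor through the space of absolutely summable sequences\<close>

lemma absolutely_summable_of_bounded_sums:
  fixes a :: "nat \<Rightarrow> real"
  assumes "\<And>N. (\<Sum>n<N. \<bar>a n\<bar>) \<le> C"
  shows "summable (\<lambda>n. \<bar>a n\<bar>)"
  by (rule bounded_imp_summable[where B = C])
    (use assms[of "Suc _"] in \<open>auto simp: lessThan_Suc_atMost\<close>)

text \<open>The composition of \<open>x \<mapsto> (\<phi>\<^sub>n(x))\<^sub>n\<close> from \<open>E\<close> to \<open>\<ell>\<^sub>1\<close> with the operator that maps the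
  unit vectors of \<open>\<ell>\<^sub>1\<close> to the \<open>y\<^sub>n\<close>.\<close>

lemma exists_synthesis_operator:
  fixes \<phi> :: "nat \<Rightarrow> 'e::real_normed_vector \<Rightarrow>\<^sub>L real" and y :: "nat \<Rightarrow> 'x::banach"
  assumes sum: "\<And>x N. (\<Sum>n<N. \<bar>\<phi> n x\<bar>) \<le> C * norm x"
    and y: "\<And>n. norm (y n) \<le> 1"
  obtains T :: "'e \<Rightarrow>\<^sub>L 'x"
    where "\<And>x. (\<lambda>n. \<phi> n x *\<^sub>R y n) sums T x"
      and "\<And>x. norm (T x) \<le> (\<Sum>n. \<bar>\<phi> n x\<bar>)"
proof -
  define t where "t x = (\<Sum>n. \<phi> n x *\<^sub>R y n)" for x
  have abs: "summable (\<lambda>n. \<bar>\<phi> n x\<bar>)" for x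
    using sum by (rule absolutely_summable_of_bounded_sums)
  have le: "norm (\<phi> n x *\<^sub>R y n) \<le> \<bar>\<phi> n x\<bar>" for n x
    using y[of n] by (simp add: mult_left_le)
  have nsm: "summable (\<lambda>n. norm (\<phi> n x *\<^sub>R y n))" for x
    by (rule summable_comparison_test'[OF abs]) (use le in auto)
  then have sums: "(\<lambda>n. \<phi> n x *\<^sub>R y n) sums t x" for x
    unfolding t_def by (rule summable_sums[OF summable_norm_cancel])
  have nt: "norm (t x) \<le> (\<Sum>n. \<bar>\<phi> n x\<bar>)" for x
  proof -
    have "norm (t x) \<le> (\<Sum>n. norm (\<phi> n x *\<^sub>R y n))"
      unfolding t_def using nsm by (rule summable_norm)
    also have "\<dots> \<le> (\<Sum>n. \<bar>\<phi> n x\<bar>)"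
      using le nsm abs by (rule suminf_le)
    finally show ?thesis .
  qed
  have bl: "bounded_linear t"
  proof (rule bounded_linear_intro[where K = C])
    show "t (a + b) = t a + t b" for a b
      using sums_unique2[OF sums[of "a + b"]] sums_add[OF sums[of a] sums[of b]]
      by (simp add: blinfun.add_right scaleR_add_left)
    show "t (r *\<^sub>R a) = r *\<^sub>R t a" for r a
      using sums_unique2[OF sums[of "r *\<^sub>R a"]] sums_scaleR_right[OF sums[of a], of r]
      by (simp add: blinfun.scaleR_right)
    show "norm (t x) \<le> norm x * C" for x
      using nt[of x] suminf_le_const[OF abs sum, of x] by (simp add: mult.commute)
  qed
  show thesis
    using that[of "Blinfun t"] sums nt by (simp add: bounded_linear_Blinfun_apply[OF bl])
qed

text \<open>The series of the \<open>\<phi>\<^sub>n\<close> is weakly unconditionally Cauchy: for signs \<open>\<epsilon>\<^sub>n = \<plusminus>1\<close> all finite sums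
  \<open>\<Sum>\<epsilon>\<^sub>n \<phi>\<^sub>n\<close> have norm at most \<open>C\<close>, and the best choice of signs for \<open>F\<close> turns
  \<open>F(\<Sum>\<epsilon>\<^sub>n \<phi>\<^sub>n)\<close> into \<open>\<Sum>\<bar>F(\<phi>\<^sub>n)\<bar>\<close>.\<close>

lemma bidual_absolutely_summable:
  fixes \<phi> :: "nat \<Rightarrow> 'e::real_normed_vector \<Rightarrow>\<^sub>L real" and F :: "('e \<Rightarrow>\<^sub>L real) \<Rightarrow>\<^sub>L real"
  assumes sum: "\<And>x N. (\<Sum>n<N. \<bar>\<phi> n x\<bar>) \<le> C * norm x"
    and C: "0 \<le> C"
  shows "summable (\<lambda>n. \<bar>F (\<phi> n)\<bar>)"
proof (rule absolutely_summable_of_bounded_sums)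
  fix N
  define \<psi> where "\<psi> = (\<Sum>n<N. sgn (F (\<phi> n)) *\<^sub>R \<phi> n)"
  have "norm (\<psi> x) \<le> C * norm x" for x
  proof -
    have "\<bar>\<psi> x\<bar> \<le> (\<Sum>n<N. \<bar>sgn (F (\<phi> n)) * \<phi> n x\<bar>)"
      by (simp add: \<psi>_def blinfun.sum_left blinfun.scaleR_left sum_abs)
    also have "\<dots> \<le> (\<Sum>n<N. \<bar>\<phi> n x\<bar>)"
      by (intro sum_mono) (simp add: abs_mult abs_sgn_eq)
    finally show ?thesis using sum[of x N] by simp
  qed
  then have "norm \<psi> \<le> C" using C by (intro norm_blinfun_bound) auto
  have "(\<Sum>n<N. \<bar>F (\<phi> n)\<bar>) = F \<psi>"
    by (simp add: \<psi>_def blinfun.sum_right blinfun.scaleR_right abs_sgn mult.commute)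
  also have "\<dots> \<le> norm F * norm \<psi>"
    using norm_blinfun[of F \<psi>] by simp
  also have "\<dots> \<le> norm F * C"
    using \<open>norm \<psi> \<le> C\<close> by (simp add: mult_left_mono)
  finally show "(\<Sum>n<N. \<bar>F (\<phi> n)\<bar>) \<le> norm F * C" .
qed

text \<open>If tails are not uniformly small, then for every \<open>N\<close> a block sum of absolute values starting at
  \<open>N\<close> exceeds \<open>e\<close> at some \<open>x\<^sub>N \<in> K\<close>. With the signs of the values at \<open>x\<^sub>N\<close>, the blocks become
  functionals \<open>\<psi>\<^sub>N\<close> with \<open>\<psi>\<^sub>N(x\<^sub>N) > e\<close>. They are weakly null, since
  \<open>\<bar>F(\<psi>\<^sub>N)\<bar>\<close> is at most the tail from \<open>N\<close> on of a convergent series. This contradicts the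
  Dunford-Pettis property of \<open>K\<close>.\<close>

lemma Dunford_Pettis_set_uniform_tails:
  fixes \<phi> :: "nat \<Rightarrow> 'e::real_normed_vector \<Rightarrow>\<^sub>L real"
  assumes sum: "\<And>x N. (\<Sum>n<N. \<bar>\<phi> n x\<bar>) \<le> C * norm x"
    and C: "0 \<le> C"
    and K: "Dunford_Pettis_set K"
    and e: "0 < e"
  obtains N where "\<And>x M. x \<in> K \<Longrightarrow> (\<Sum>n=N..<M. \<bar>\<phi> n x\<bar>) \<le> e"
proof (rule ccontr)
  assume "\<not> thesis"
  then have "\<forall>N. \<exists>x M. x \<in> K \<and> e < (\<Sum>n=N..<M. \<bar>\<phi> n x\<bar>)"
    using that by (meson not_less)
  then obtain x M where xM: "\<And>N. x N \<in> K" "\<And>N. e < (\<Sum>n=N..<M N. \<bar>\<phi> n (x N)\<bar>)"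
    by metis
  define \<psi> where "\<psi> N = (\<Sum>n=N..<M N. sgn (\<phi> n (x N)) *\<^sub>R \<phi> n)" for N
  have "weakly_null \<psi>"
    unfolding weakly_null_def
  proof
    fix F :: "('e \<Rightarrow>\<^sub>L real) \<Rightarrow>\<^sub>L real"
    have sm: "summable (\<lambda>n. \<bar>F (\<phi> n)\<bar>)"
      using sum C by (rule bidual_absolutely_summable)
    show "(\<lambda>N. F (\<psi> N)) \<longlonglongrightarrow> 0"
    proof (rule LIMSEQ_I)
      fix r :: real assume "0 < r"
      with sm obtain N0 where N0: "\<And>m n. m \<ge> N0 \<Longrightarrow> norm (\<Sum>k=m..<n. \<bar>F (\<phi> k)\<bar>) < r"
        unfolding summable_Cauchy by meson
      have "norm (F (\<psi> N) - 0) < r" if "N \<ge> N0" for N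
      proof -
        have "\<bar>F (\<psi> N)\<bar> \<le> (\<Sum>n=N..<M N. \<bar>sgn (\<phi> n (x N)) * F (\<phi> n)\<bar>)"
          by (simp add: \<psi>_def blinfun.sum_right blinfun.scaleR_right sum_abs)
        also have "\<dots> \<le> (\<Sum>n=N..<M N. \<bar>F (\<phi> n)\<bar>)"
          by (intro sum_mono) (simp add: abs_mult abs_sgn_eq)
        also have "\<dots> < r" using N0[OF that, of "M N"] by simp
        finally show ?thesis by simp
      qed
      then show "\<exists>no. \<forall>n\<ge>no. norm (F (\<psi> n) - 0) < r" by blast
    qed
  qed
  then have "uniform_limit K (\<lambda>n. blinfun_apply (\<psi> n)) (\<lambda>_. 0) sequentially"
    using K by (simp add: Dunford_Pettis_set_def)
  then obtain N where "\<And>z. z \<in> K \<Longrightarrow> \<bar>\<psi> N z\<bar> < e"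
    using e unfolding uniform_limit_iff eventually_sequentially dist_real_def by force
  then have "\<bar>\<psi> N (x N)\<bar> < e" using xM(1) by blast
  moreover have "\<psi> N (x N) = (\<Sum>n=N..<M N. \<bar>\<phi> n (x N)\<bar>)"
    by (simp add: \<psi>_def blinfun.sum_left blinfun.scaleR_left abs_sgn mult.commute)
  ultimately show False using xM(2)[of N] by simp
qed

lemma weakly_p_summable_imp_tendsto_zero:
  fixes f :: "'z::real_normed_vector \<Rightarrow>\<^sub>L real"
  assumes "0 < p" "weakly_p_summable p x"
  shows "(\<lambda>n. blinfun_apply f (x n)) \<longlonglongrightarrow> 0"
proof -
  have "(\<lambda>n. \<bar>f (x n)\<bar> powr p) \<longlonglongrightarrow> 0"
    using assms(2) by (intro summable_LIMSEQ_zero) (simp add: weakly_p_summable_def)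
  then have "(\<lambda>n. (\<bar>f (x n)\<bar> powr p) powr (1 / p)) \<longlonglongrightarrow> 0 powr (1 / p)"
    using assms(1) by (intro tendsto_powr') auto
  then have "(\<lambda>n. \<bar>f (x n)\<bar>) \<longlonglongrightarrow> 0"
    using assms(1) by (simp add: powr_powr)
  then show ?thesis by (simp add: tendsto_rabs_zero_iff)
qed

text \<open>The norms \<open>\<Sum>\<bar>\<phi>\<^sub>n(x\<^sub>k)\<bar>\<close> in \<open>\<ell>\<^sub>1\<close> split into finitely many coordinates, which tend
  to \<open>0\<close> as \<open>k\<close> grows by \<open>p\<close>-summability, and a tail that is small uniformly in \<open>k\<close> by the
  Dunford-Pettis property of the range.\<close>

lemma Dunford_Pettis_p_convergent_of_summable_functionals:
  fixes \<phi> :: "nat \<Rightarrow> 'e::real_normed_vector \<Rightarrow>\<^sub>L real" and T :: "'e \<Rightarrow>\<^sub>L 'x::real_normed_vector"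
  assumes sum: "\<And>x N. (\<Sum>n<N. \<bar>\<phi> n x\<bar>) \<le> C * norm x"
    and C: "0 \<le> C"
    and T: "\<And>x. norm (T x) \<le> (\<Sum>n. \<bar>\<phi> n x\<bar>)"
    and p: "0 < p"
  shows "Dunford_Pettis_p_convergent p T"
  unfolding Dunford_Pettis_p_convergent_def
proof (intro allI impI)
  fix x :: "nat \<Rightarrow> 'e"
  assume wps: "weakly_p_summable p x" and K: "Dunford_Pettis_set (range x)"
  show "(\<lambda>k. T (x k)) \<longlonglongrightarrow> 0"
  proof (rule LIMSEQ_I)
    fix r :: real assume "0 < r"
    obtain N where "\<And>z M. z \<in> range x \<Longrightarrow> (\<Sum>n=N..<M. \<bar>\<phi> n z\<bar>) \<le> r / 2"
      by (rule Dunford_Pettis_set_uniform_tails[OF sum C K half_gt_zero[OF \<open>0 < r\<close>]]) (rule that)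
    then have N: "(\<Sum>n=N..<M. \<bar>\<phi> n (x k)\<bar>) \<le> r / 2" for k M
      by blast
    have "(\<lambda>k. \<Sum>n<N. \<bar>\<phi> n (x k)\<bar>) \<longlonglongrightarrow> (\<Sum>n<N. \<bar>0\<bar>)"
      by (intro tendsto_intros weakly_p_summable_imp_tendsto_zero[OF p wps])
    then have "eventually (\<lambda>k. (\<Sum>n<N. \<bar>\<phi> n (x k)\<bar>) < r / 2) sequentially"
      using \<open>0 < r\<close> by (intro order_tendstoD) auto
    then obtain k0 where k0: "\<And>k. k \<ge> k0 \<Longrightarrow> (\<Sum>n<N. \<bar>\<phi> n (x k)\<bar>) < r / 2"
      unfolding eventually_sequentially by blast
    have "norm (T (x k) - 0) < r" if "k \<ge> k0" for k
    proof -
      have "(\<Sum>n. \<bar>\<phi> n (x k)\<bar>) \<le> (\<Sum>n<N. \<bar>\<phi> n (x k)\<bar>) + r / 2"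
      proof (rule suminf_le_const)
        show "summable (\<lambda>n. \<bar>\<phi> n (x k)\<bar>)"
          using sum by (rule absolutely_summable_of_bounded_sums)
        fix M
        have "(\<Sum>n<M. \<bar>\<phi> n (x k)\<bar>) \<le> (\<Sum>n\<in>{..<N} \<union> {N..<M}. \<bar>\<phi> n (x k)\<bar>)"
          by (intro sum_mono2) auto
        also have "\<dots> = (\<Sum>n<N. \<bar>\<phi> n (x k)\<bar>) + (\<Sum>n=N..<M. \<bar>\<phi> n (x k)\<bar>)"
          by (intro sum.union_disjoint) auto
        finally show "(\<Sum>n<M. \<bar>\<phi> n (x k)\<bar>) \<le> (\<Sum>n<N. \<bar>\<phi> n (x k)\<bar>) + r / 2"
          using N[where k = k and M = M] by linarith
      qed
      then show ?thesis using T[of "x k"] k0[OF that] by simp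
    qed
    then show "\<exists>no. \<forall>k\<ge>no. norm (T (x k) - 0) < r" by blast
  qed
qed

section \<open>Weak* null sequences that are not norm null\<close>

text \<open>After \<open>y\<^sub>0, \<dots>, y\<^sub>n\<^sub>-\<^sub>1\<close> have been chosen, all late members of the sequence are small at these
  finitely many vectors, and some of them still have norm greater than \<open>\<eta>\<close>.\<close>

lemma almost_triangular_unit_vectors:
  fixes f :: "nat \<Rightarrow> 'x::real_normed_vector \<Rightarrow>\<^sub>L real"
  assumes null: "\<And>y. (\<lambda>n. f n y) \<longlonglongrightarrow> 0"
    and freq: "\<exists>\<^sub>F n in sequentially. \<eta> < norm (f n)"
    and "0 \<le> \<eta>" "0 < d"
  obtains k y where "\<And>n. n \<le> k n" "\<And>n. norm (y n) \<le> 1" "\<And>n. \<eta> < f (k n) (y n)"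
    and "\<And>m n. m < n \<Longrightarrow> \<bar>f (k n) (y m)\<bar> < d"
proof -
  have "\<exists>s. \<forall>n. n \<le> fst (s n) \<and> norm (snd (s n)) \<le> 1 \<and> \<eta> < f (fst (s n)) (snd (s n)) \<and>
      (\<forall>m<n. \<bar>f (fst (s n)) (snd (s m))\<bar> < d)"
  proof (rule dependent_wellorder_choice)
    fix n and s :: "nat \<Rightarrow> nat \<times> 'x"
    have "eventually (\<lambda>k. \<forall>m\<in>{..<n}. \<bar>f k (snd (s m))\<bar> < d) sequentially"
    proof (intro eventually_ball_finite ballI)
      fix m
      show "eventually (\<lambda>k. \<bar>f k (snd (s m))\<bar> < d) sequentially"
        using tendsto_rabs_zero[OF null] \<open>0 < d\<close> by (rule order_tendstoD)
    qed simp
    from frequently_eventually_conj[OF freq eventually_conj[OF this eventually_ge_at_top[of n]]]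
    have "\<exists>\<^sub>F k in sequentially. ((\<forall>m\<in>{..<n}. \<bar>f k (snd (s m))\<bar> < d) \<and> n \<le> k) \<and> \<eta> < norm (f k)"
      .
    then obtain k where k: "\<eta> < norm (f k)" "n \<le> k" "\<forall>m<n. \<bar>f k (snd (s m))\<bar> < d"
      by (auto dest!: frequently_ex)
    obtain y where "norm y \<le> 1" "\<eta> < f k y"
      by (rule exists_unit_vector_above[OF \<open>0 \<le> \<eta>\<close> k(1)])
    with k show "\<exists>r. n \<le> fst r \<and> norm (snd r) \<le> 1 \<and> \<eta> < f (fst r) (snd r) \<and>
      (\<forall>m<n. \<bar>f (fst r) (snd (s m))\<bar> < d)"
      by (intro exI[of _ "(k, y)"]) auto
  qed auto
  then obtain s where "\<And>n. n \<le> fst (s n) \<and> norm (snd (s n)) \<le> 1 \<and> \<eta> < f (fst (s n)) (snd (s n)) \<and>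
      (\<forall>m<n. \<bar>f (fst (s n)) (snd (s m))\<bar> < d)"
    by blast
  then show thesis
    by (intro that[of "\<lambda>n. fst (s n)" "\<lambda>n. snd (s n)"]) auto
qed

section \<open>The dichotomy\<close>

lemma sum_consecutive_differences:
  fixes g :: "nat \<Rightarrow> 'e::real_normed_vector \<Rightarrow>\<^sub>L real"
  assumes "a \<le> b"
  shows "(\<Sum>n=a..<b. (g n - g (Suc n)) x) = g a x - g b x"
  using assms by (induction b rule: dec_induct) (auto simp: blinfun.diff_left)

theorem theorem3p19:
  fixes p :: real
  assumes "1 \<le> p"
    and "\<And>T :: 'e::banach_lattice \<Rightarrow>\<^sub>L 'x::banach.
           Dunford_Pettis_p_convergent p T \<Longrightarrow> Dunford_Pettis_p_convergent p (blinfun_adjoint T)"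
  shows "order_continuous_norm TYPE('i) TYPE('e \<Rightarrow>\<^sub>L real) \<or> p_DPrcP p TYPE('x \<Rightarrow>\<^sub>L real)"
proof (rule ccontr)
  assume "\<not> ?thesis"
  then have noc: "\<not> order_continuous_norm TYPE('i) TYPE('e \<Rightarrow>\<^sub>L real)"
    and "\<not> p_DPrcP p TYPE('x \<Rightarrow>\<^sub>L real)" by auto
  then obtain f :: "nat \<Rightarrow> 'x \<Rightarrow>\<^sub>L real" where wps: "weakly_p_summable p f"
    and DP: "Dunford_Pettis_set (range f)" and "\<not> f \<longlonglongrightarrow> 0"
    unfolding p_DPrcP_def by blast
  then obtain \<eta>' where "0 < \<eta>'" and freq': "\<exists>\<^sub>F n in sequentially. \<not> norm (f n) < \<eta>'"
    by (auto simp: tendsto_iff frequently_def)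
  \<comment> \<open>Halving turns the weak inequality into the strict one.\<close>
  define \<eta> where "\<eta> = \<eta>' / 2"
  have \<eta>: "0 < \<eta>" and freq: "\<exists>\<^sub>F n in sequentially. \<eta> < norm (f n)"
    using \<open>0 < \<eta>'\<close> by (auto simp: \<eta>_def intro: frequently_elim1[OF freq'])
  obtain B where B: "0 < B" "\<And>k. norm (f k) \<le> B"
    using DP unfolding Dunford_Pettis_set_def bounded_pos by auto
  have null: "(\<lambda>n. f n y) \<longlonglongrightarrow> 0" for y
  proof -
    have "bounded_linear (\<lambda>h :: 'x \<Rightarrow>\<^sub>L real. blinfun_apply h y)"
      by (rule blinfun.bounded_linear_left)
    then show ?thesis
      using weakly_p_summable_imp_tendsto_zero[OF _ wps, of "Blinfun (\<lambda>h. blinfun_apply h y)"] assms(1)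
      by (simp add: bounded_linear_Blinfun_apply)
  qed
  obtain c where c: "0 < c" and ex: "\<And>d. 0 < d \<Longrightarrow>
      \<exists>(g :: nat \<Rightarrow> 'e \<Rightarrow>\<^sub>L real) u. (\<forall>n. 0 \<le> g n \<and> g (Suc n) \<le> g n \<and>
           0 \<le> u n \<and> norm (u n) \<le> 1 \<and> c < blinfun_apply (g n) (u n) \<and> blinfun_apply (g (Suc n)) (u n) < d)"
    by (rule decreasing_functionals_of_not_order_continuous[OF noc]) (rule that)
  \<comment> \<open>The first entry keeps \<open>\<phi> n (u n)\<close> above \<open>c / 2\<close>, so that the diagonal term below is at least
    \<open>c * \<eta> / 2\<close>. The second one and \<open>d'\<close> limit the two off-diagonal parts to \<open>c * \<eta> / 8\<close> each.\<close>
  define d where "d = min (c / 2) (c * \<eta> / (8 * B))"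
  have d: "0 < d" "d \<le> c / 2" "d * B \<le> c * \<eta> / 8"
    using c \<eta> B(1) by (auto simp: d_def min_def field_simps)
  obtain g :: "nat \<Rightarrow> 'e \<Rightarrow>\<^sub>L real" and u where gu: "\<And>n. 0 \<le> g n \<and> g (Suc n) \<le> g n \<and>
           0 \<le> u n \<and> norm (u n) \<le> 1 \<and> c < blinfun_apply (g n) (u n) \<and> blinfun_apply (g (Suc n)) (u n) < d"
    using ex[OF d(1)] by metis
  \<comment> \<open>The total mass of the terms before the diagonal is only known to be at most \<open>norm (g 0)\<close>, so this
    bound can be fixed only after \<open>g\<close>.\<close>
  define d' where "d' = c * \<eta> / (8 * (norm (g 0) + 1))"
  have d': "0 < d'" "norm (g 0) * d' \<le> c * \<eta> / 8"
  proof -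
    have *: "0 < norm (g 0) + 1" using norm_ge_zero[of "g 0"] by linarith
    then show "0 < d'" using c \<eta> by (simp add: d'_def)
    have "norm (g 0) * d' \<le> (norm (g 0) + 1) * d'"
      using \<open>0 < d'\<close> by (simp add: mult_right_mono)
    also have "\<dots> = c * \<eta> / 8" using * by (simp add: d'_def field_simps)
    finally show "norm (g 0) * d' \<le> c * \<eta> / 8" .
  qed
  obtain k y where ky: "\<And>n. n \<le> k n" "\<And>n. norm (y n) \<le> 1" "\<And>n. \<eta> < f (k n) (y n)"
    "\<And>m n. m < n \<Longrightarrow> \<bar>f (k n) (y m)\<bar> < d'"
    using almost_triangular_unit_vectors[OF null freq _ d'(1)] \<eta> by auto
  define \<phi> where "\<phi> n = g n - g (Suc n)" for n
  have \<phi>_pos: "0 \<le> \<phi> n" for n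
    using gu[of n] by (simp add: \<phi>_def less_eq_blinfun_def blinfun.diff_left)
  then have \<phi>_pos': "0 \<le> \<phi> n x" if "0 \<le> x" for n x
    using that by (simp add: less_eq_blinfun_def)
  have tel: "(\<Sum>n=a..<b. \<phi> n x) \<le> g a x" if "0 \<le> x" for a b x
  proof (cases "a \<le> b")
    case True
    then show ?thesis
      using gu[of b] that sum_consecutive_differences[OF True, of g x]
      by (simp add: \<phi>_def less_eq_blinfun_def)
  next
    case False
    then show ?thesis using gu[of a] that by (simp add: less_eq_blinfun_def)
  qed
  have sum: "(\<Sum>n<N. \<bar>\<phi> n x\<bar>) \<le> norm (g 0) * norm x" for x N
  proof -
    have "(\<Sum>n<N. \<bar>\<phi> n x\<bar>) \<le> (\<Sum>n=0..<N. \<phi> n \<bar>x\<bar>)"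
      unfolding lessThan_atLeast0
      by (intro sum_mono positive_functional_abs_le \<phi>_pos)
    also have "\<dots> \<le> g 0 \<bar>x\<bar>" by (rule tel) simp
    also have "\<dots> \<le> norm (g 0) * norm \<bar>x\<bar>"
      using norm_blinfun[of "g 0" "\<bar>x\<bar>"] by simp
    finally show ?thesis by (simp add: norm_abs_lattice)
  qed
  obtain T :: "'e \<Rightarrow>\<^sub>L 'x" where T: "\<And>x. (\<lambda>n. \<phi> n x *\<^sub>R y n) sums T x"
    "\<And>x. norm (T x) \<le> (\<Sum>n. \<bar>\<phi> n x\<bar>)"
    by (rule exists_synthesis_operator[OF sum ky(2)]) (rule that)
  have "Dunford_Pettis_p_convergent p T"
    by (rule Dunford_Pettis_p_convergent_of_summable_functionals[OF sum _ T(2)])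
      (use assms(1) in auto)
  then have "Dunford_Pettis_p_convergent p (blinfun_adjoint T)" by (rule assms(2))
  then have "(\<lambda>n. blinfun_adjoint T (f n)) \<longlonglongrightarrow> 0"
    using wps DP by (simp add: Dunford_Pettis_p_convergent_def)
  then have "eventually (\<lambda>n. norm (blinfun_adjoint T (f n)) < c * \<eta> / 4) sequentially"
    using c \<eta> by (intro order_tendstoD(2)[OF tendsto_norm_zero]) auto
  then obtain n where n: "\<And>j. j \<ge> n \<Longrightarrow> norm (blinfun_adjoint T (f j)) < c * \<eta> / 4"
    unfolding eventually_sequentially by blast
  define F where "F = f (k n)"
  have "F (T (u n)) = blinfun_adjoint T F (u n)"
    by (simp add: blinfun_adjoint.rep_eq)
  also have "\<dots> \<le> norm (blinfun_adjoint T F) * norm (u n)"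
    using norm_blinfun[of "blinfun_adjoint T F" "u n"] by simp
  also have "\<dots> \<le> norm (blinfun_adjoint T F)"
    using gu[of n] by (simp add: mult_left_le)
  also have "\<dots> < c * \<eta> / 4" using n ky(1) by (simp add: F_def)
  finally have upper: "F (T (u n)) < c * \<eta> / 4" .
  have u: "0 \<le> u n" "norm (u n) \<le> 1" using gu by auto
  \<comment> \<open>The diagonal term is estimated from below, the terms before it by the choice of \<open>y\<close>, and those
    after it by the smallness of \<open>g (Suc n) (u n)\<close>.\<close>
  have lower: "c * \<eta> / 4 \<le> (\<Sum>m<N. \<phi> m (u n) * F (y m))" if "n < N" for N
  proof -
    have split: "{..<N} = insert n ({0..<n} \<union> {Suc n..<N})"
      using that by auto
    have "(\<Sum>m<N. \<phi> m (u n) * F (y m)) = \<phi> n (u n) * F (y n) +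
        ((\<Sum>m=0..<n. \<phi> m (u n) * F (y m)) + (\<Sum>m=Suc n..<N. \<phi> m (u n) * F (y m)))"
      unfolding split by (subst sum.insert) (auto simp: sum.union_disjoint)
    moreover have "c * \<eta> / 2 \<le> \<phi> n (u n) * F (y n)"
    proof -
      have "c / 2 \<le> \<phi> n (u n)"
        using gu[of n] d(2) unfolding \<phi>_def blinfun.diff_left by linarith
      moreover have "\<eta> \<le> F (y n)" using ky(3)[of n] by (simp add: F_def)
      ultimately have "c / 2 * \<eta> \<le> \<phi> n (u n) * F (y n)"
        using c \<eta> by (intro mult_mono) auto
      then show ?thesis by simp
    qed
    moreover have "- (c * \<eta> / 8) \<le> (\<Sum>m=0..<n. \<phi> m (u n) * F (y m))"
    proof -
      have "(\<Sum>m=0..<n. \<phi> m (u n)) \<le> norm (g 0)"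
        using sum[of "u n" n] u \<phi>_pos' mult_left_le[OF u(2), of "norm (g 0)"]
        by (simp add: lessThan_atLeast0)
      from mult_right_mono[OF this less_imp_le[OF d'(1)]] d'(2)
      have "(\<Sum>m=0..<n. \<phi> m (u n)) * d' \<le> c * \<eta> / 8"
        by (rule order_trans)
      moreover have "(\<Sum>m=0..<n. \<phi> m (u n) * - d') \<le> (\<Sum>m=0..<n. \<phi> m (u n) * F (y m))"
      proof (intro sum_mono mult_left_mono)
        fix m assume "m \<in> {0..<n}"
        then have "\<bar>F (y m)\<bar> < d'" using ky(4)[of m n] by (simp add: F_def)
        then show "- d' \<le> F (y m)" by linarith
      qed (use u \<phi>_pos' in auto)
      ultimately show ?thesis unfolding sum_distrib_right[symmetric] by simp
    qed
    moreover have "- (c * \<eta> / 8) \<le> (\<Sum>m=Suc n..<N. \<phi> m (u n) * F (y m))"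
    proof -
      have FB: "- B \<le> F (y m)" for m
      proof -
        have "\<bar>F (y m)\<bar> \<le> norm F * norm (y m)"
          using norm_blinfun[of F "y m"] by simp
        also have "\<dots> \<le> norm F" using ky(2)[of m] by (simp add: mult_left_le)
        also have "\<dots> \<le> B" using B(2) by (simp add: F_def)
        finally show ?thesis by linarith
      qed
      have "(\<Sum>m=Suc n..<N. \<phi> m (u n)) \<le> d"
        using tel[OF u(1), of "Suc n" N] gu[of n] by linarith
      from mult_right_mono[OF this less_imp_le[OF B(1)]] d(3)
      have "(\<Sum>m=Suc n..<N. \<phi> m (u n)) * B \<le> c * \<eta> / 8"
        by (rule order_trans)
      moreover have "(\<Sum>m=Suc n..<N. \<phi> m (u n) * - B) \<le> (\<Sum>m=Suc n..<N. \<phi> m (u n) * F (y m))"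
        using FB u \<phi>_pos' by (intro sum_mono mult_left_mono) auto
      ultimately show ?thesis unfolding sum_distrib_right[symmetric] by simp
    qed
    ultimately show ?thesis by linarith
  qed
  have "(\<lambda>m. \<phi> m (u n) * F (y m)) sums F (T (u n))"
    using bounded_linear.sums[OF blinfun.bounded_linear_right T(1)[of "u n"], of F]
    by (simp add: blinfun.scaleR_right)
  then have "c * \<eta> / 4 \<le> F (T (u n))"
    unfolding sums_def by (rule LIMSEQ_le_const) (use lower in \<open>auto intro!: exI[of _ "Suc n"]\<close>)
  with upper show False by simp
qed

end
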